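(* Let $D\in\mathfrak{der}(\widetilde P)$ be an affine bundle derivative, i.e. a hermitian $H$-covariant first-order antiderivation $D\colon\mathfrak{h}[\widetilde P]\to\mathfrak{h}[\widetilde P]$ extending $d_M\colon\Omega_M\to\Omega_M$. Let $\lambda=D{\restriction}\mathbb{V}\colon\mathbb{V}\to\mathrm{hor}_P$, and let $\varrho_D\colon\widetilde{\mathcal{A}}\to\mathfrak{h}[\widetilde P]$ be the curvature map of $D$, which extends the curvature map $\varrho_D\colon\mathcal{A}\to\mathrm{hor}_P$ of the restriction $D\colon\mathrm{hor}_P\to\mathrm{hor}_P$. Then $$\varrho_D(\theta)=-\sum_k\theta_k\varrho_D(c_k)-D\lambda(\theta)$$ for each $\theta\in\mathbb{V}$, where $\sum_k\theta_k\otimes c_k=\varkappa(\theta)$.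
   Context: All algebras are complex and unital; $\phi(a)=a^{(1)}\otimes a^{(2)}$ is Sweedler notation. $\mathcal{A}$ is the Hopf $*$-algebra (coproduct $\phi$, counit $\epsilon$, antipode $\kappa$) of polynomial functions on a compact matrix quantum group $G$. Affine extension of the group. $\Psi$ is a bicovariant $*$-bimodule over $\mathcal{A}$, $\mathbb{V}=\Psi_{inv}$ its $*$-invariant subspace of left-invariant elements, with right $\mathcal{A}$-comodule structure $\varkappa\colon\mathbb{V}\to\mathbb{V}\otimes\mathcal{A}$ (restriction of the right coaction) and right $\mathcal{A}$-module structure $\theta\circ a=\kappa(a^{(1)})\theta a^{(2)}$. With $\varkappa(\theta)=\sum_k\theta_k\otimes c_k$ one has $\varkappa(\theta\circ a)=\sum_k(\theta_k\circ a^{(2)})\otimes\kappa(a^{(1)})c_ka^{(3)}$, $\varkappa*=( *\otimes* )\varkappa$, $(\theta\circ a)^*=\theta^*\circ\kappa(a)^*$. These structures extend to the tensor algebra $\mathbb{V}^\otimes$ by $\varkappa(\theta\eta)=\varkappa(\theta)\varkappa(\eta)$, $(\theta\eta)^*=\eta^*\theta^*$, $(\theta\eta)\circ a=(\theta\circ a^{(1)})(\eta\circ a^{(2)})$, $1\circ a=\epsilon(a)1$. The braid operator is $\tau(\eta\otimes\theta)=\sum_k\theta_k\otimes(\eta\circ c_k)$ on $\mathbb{V}^{\otimes2}$; for $\pi\in S_n$, $\tau_\pi$ is obtained from a minimal decomposition of $\pi$ into adjacent transpositions by replacing each transposition by the corresponding $\tau$; $Y_n=\sum_{\pi\in S_n}\tau_\pi$,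 $Y=\oplus_nY_n$. $S(\mathbb{V})=\mathbb{V}^\otimes/\ker Y$ is a graded $*$-algebra to which $\varkappa,\circ$ descend. $\widetilde{\mathcal{A}}$ is the Hopf $*$-algebra generated by $\mathcal{A}$ and $S(\mathbb{V})$ with relations $\theta a=a^{(1)}(\theta\circ a^{(2)})$, multiplication giving a linear isomorphism $\mathcal{A}\otimes S(\mathbb{V})\cong\widetilde{\mathcal{A}}$, with $\phi,\epsilon,\kappa,*$ extending those of $\mathcal{A}$ and $\phi(\theta)=1\otimes\theta+\varkappa(\theta)$, $\epsilon(\theta)=0$, $\kappa(\theta)=-\sum_k\theta_k\kappa(c_k)$ for $\theta\in\mathbb{V}$. $\widehat\varkappa\colon S(\mathbb{V})\to S(\mathbb{V})\otimes\widetilde{\mathcal{A}}$ is the restriction of $\phi$. Bundle and horizontal forms. $P=(\mathcal{B},i,F)$ is a quantum principal $G$-bundle over a quantum space $M$: $\mathcal{B}$ is a $*$-algebra, $F\colon\mathcal{B}\to\mathcal{B}\otimes\mathcal{A}$ a counital coassociative $*$-homomorphism, $\mathcal{V}$ (identified via $i$) its fixed-point subalgebra, and $q\otimes b\mapsto(q\otimes1)F(b)$, $\mathcal{B}\otimes_{\mathcal{V}}\mathcal{B}\to\mathcal{B}\otimes\mathcal{A}$, is surjective (hence bijective, as is known for compact $G$). $\mathrm{hor}_P$ is a graded $*$-algebra with $\mathrm{hor}_P^0=\mathcal{B}$ (convention: $(\varphi\psi)^*=(-1)^{\partial\varphi\partial\psi}\psi^*\varphi^*$), $F^\wedge\colon\mathrm{hor}_P\to\mathrm{hor}_P\otimes\mathcal{A}$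 is a coassociative grade-preserving $*$-homomorphism extending $F$, and $\Omega_M\subseteq\mathrm{hor}_P$ is the $F^\wedge$-fixed-point subalgebra, equipped with a hermitian first-order differential $d_M\colon\Omega_M\to\Omega_M$. $\mathfrak{h}[\widetilde P]=\mathrm{hor}_P\otimes S(\mathbb{V})$ is the $*$-algebra with $(\psi\otimes\theta)(\varphi\otimes\eta)=\sum_k\psi\varphi_k\otimes(\theta\circ c_k)\eta$ and $(\varphi\otimes\theta)^*=\sum_k\varphi_k^*\otimes(\theta^*\circ c_k^* )$, where $F^\wedge(\varphi)=\sum_k\varphi_k\otimes c_k$; it is graded by the horizontal degree $\partial$ (inherited from $\mathrm{hor}_P$, with $S(\mathbb{V})$ in degree $0$). $H\colon\mathfrak{h}[\widetilde P]\to\mathfrak{h}[\widetilde P]\otimes\widetilde{\mathcal{A}}$ is the $*$-homomorphism extending $F^\wedge$ and $\widehat\varkappa$; its fixed-point subalgebra is $\Omega_M$. A first-order antiderivation is a linear map $D$ raising the horizontal degree by $1$ with $D(\varphi\psi)=D(\varphi)\psi+(-1)^{\partial\varphi}\varphi D(\psi)$; $H$-covariant means $HD=(D\otimes\mathrm{id})H$; hermitian means commuting with $*$. It is standing that hermitian $F^\wedge$-covariant first-order antiderivations of $\mathrm{hor}_P$ extending $d_M$ exist. Every $D\in\mathfrak{der}(\widetilde P)$ satisfies $D(\mathrm{hor}_P)\subseteq\mathrm{hor}_P$ and $D(\mathbb{V})\subseteq\mathrm{hor}_P$. Curvature. The curvature of $D\in\mathfrak{der}(\widetilde P)$ is the unique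 linear map $\varrho_D\colon\widetilde{\mathcal{A}}\to\mathfrak{h}[\widetilde P]$ with $D^2(\varphi)=-\sum_k\varphi_k\varrho_D(c_k)$ for all $\varphi\in\mathfrak{h}[\widetilde P]$, $H(\varphi)=\sum_k\varphi_k\otimes c_k$; the curvature $\mathcal{A}\to\mathrm{hor}_P$ of $D{\restriction}\mathrm{hor}_P$ is defined by the same formula with $F^\wedge$ in place of $H$. One has $\varrho_D(1)=0$. *)

theory Defs
  imports Complex_Main "HOL-Library.Multiset" "HOL-Combinatorics.Permutations"
begin

section \<open>Complex vector spaces, algebras and star-algebras\<close>

class scaleC =
  fixes scaleC :: "complex \<Rightarrow> 'a \<Rightarrow> 'a"  (infixr \<open>*\<^sub>C\<close> 75)

class complex_vector = scaleC + ab_group_add +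
  assumes scaleC_add_right: "c *\<^sub>C (x + y) = c *\<^sub>C x + c *\<^sub>C y"
    and scaleC_add_left: "(c + d) *\<^sub>C x = c *\<^sub>C x + d *\<^sub>C x"
    and scaleC_scaleC: "c *\<^sub>C d *\<^sub>C x = (c * d) *\<^sub>C x"
    and scaleC_one: "1 *\<^sub>C x = x"

class complex_algebra_1 = complex_vector + ring_1 +
  assumes mult_scaleC_left: "(c *\<^sub>C x) * y = c *\<^sub>C (x * y)"
    and mult_scaleC_right: "x * (c *\<^sub>C y) = c *\<^sub>C (x * y)"

class star_op =
  fixes star :: "'a \<Rightarrow> 'a"

class complex_star_vector = complex_vector + star_op +
  assumes star_add: "star (x + y) = star x + star y"
    and star_scaleC: "star (c *\<^sub>C x) = cnj c *\<^sub>C star x"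
    and star_star: "star (star x) = x"

class complex_star_algebra = complex_algebra_1 + complex_star_vector +
  assumes star_mult: "star (x * y) = star y * star x"

instantiation complex :: complex_algebra_1
begin
definition "scaleC c (z::complex) = c * z"
instance by standard (auto simp: scaleC_complex_def algebra_simps)
end

lemma scaleC_zero_left: "0 *\<^sub>C x = (0::'a::complex_vector)"
  using scaleC_add_left[of 0 0 x] by simp

lemma scaleC_zero_right: "c *\<^sub>C 0 = (0::'a::complex_vector)"
  using scaleC_add_right[of c 0 0] by simp

definition clinear :: "('a::complex_vector \<Rightarrow> 'b::complex_vector) \<Rightarrow> bool" where
  "clinear f \<longleftrightarrow> (\<forall>x y. f (x + y) = f x + f y) \<and> (\<forall>c x. f (c *\<^sub>C x) = c *\<^sub>C f x)"

definition cbilinear :: "('a::complex_vector \<Rightarrow> 'b::complex_vector \<Rightarrow> 'c::complex_vector) \<Rightarrow> bool" where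
  "cbilinear f \<longleftrightarrow> (\<forall>x. clinear (f x)) \<and> (\<forall>y. clinear (\<lambda>x. f x y))"

definition csubspace :: "'a::complex_vector set \<Rightarrow> bool" where
  "csubspace W \<longleftrightarrow> 0 \<in> W \<and> (\<forall>x\<in>W. \<forall>y\<in>W. x + y \<in> W) \<and> (\<forall>c. \<forall>x\<in>W. c *\<^sub>C x \<in> W)"

definition alg_hom :: "('a::complex_algebra_1 \<Rightarrow> 'b::complex_algebra_1) \<Rightarrow> bool" where
  "alg_hom f \<longleftrightarrow> clinear f \<and> f 1 = 1 \<and> (\<forall>x y. f (x * y) = f x * f y)"

section \<open>Algebraic tensor products over the complex numbers\<close>

text \<open>Finite formal sums of pairs, modulo the congruence generated by bilinearity.\<close>

inductive tensor_eq ::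
  "('a::complex_vector \<times> 'b::complex_vector) multiset \<Rightarrow> ('a \<times> 'b) multiset \<Rightarrow> bool" where
  te_refl: "tensor_eq M M"
| te_sym: "tensor_eq M N \<Longrightarrow> tensor_eq N M"
| te_trans: "tensor_eq M N \<Longrightarrow> tensor_eq N K \<Longrightarrow> tensor_eq M K"
| te_add: "tensor_eq M N \<Longrightarrow> tensor_eq (M + K) (N + K)"
| te_left: "tensor_eq {#(x + x', y)#} {#(x, y), (x', y)#}"
| te_right: "tensor_eq {#(x, y + y')#} {#(x, y), (x, y')#}"
| te_scale: "tensor_eq {#(c *\<^sub>C x, y)#} {#(x, c *\<^sub>C y)#}"
| te_zero: "tensor_eq {#(0, y)#} {#}"

lemma te_equivp: "equivp tensor_eq"
  by (intro equivpI reflpI sympI transpI) (blast intro: te_refl te_sym te_trans)+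

lemma te_add2: "tensor_eq M N \<Longrightarrow> tensor_eq K L \<Longrightarrow> tensor_eq (M + K) (N + L)"
  by (metis te_add te_trans add.commute)

lemma te_scale_image:
  "tensor_eq M N \<Longrightarrow>
    tensor_eq (image_mset (\<lambda>(x, y). (c *\<^sub>C x, y)) M) (image_mset (\<lambda>(x, y). (c *\<^sub>C x, y)) N)"
proof (induction rule: tensor_eq.induct)
  case (te_scale d x y)
  have "tensor_eq {#(d *\<^sub>C (c *\<^sub>C x), y)#} {#(c *\<^sub>C x, d *\<^sub>C y)#}" by (rule tensor_eq.te_scale)
  then show ?case by (simp add: scaleC_scaleC mult.commute)
qed (auto simp: scaleC_add_right scaleC_zero_right intro: tensor_eq.intros)

lemma te_uminus_image:
  "tensor_eq M N \<Longrightarrow>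
    tensor_eq (image_mset (\<lambda>(x, y). (- x, y)) M) (image_mset (\<lambda>(x, y). (- x, y)) N)"
proof (induction rule: tensor_eq.induct)
  case (te_left x x' y)
  show ?case using tensor_eq.te_left[of "- x" "- x'" y] by (simp add: add.commute)
next
  case (te_scale d x y)
  have "d *\<^sub>C (- x) = - (d *\<^sub>C x)"
    by (metis add.right_inverse add_eq_0_iff2 scaleC_add_right scaleC_zero_right)
  then show ?case using tensor_eq.te_scale[of d "- x" y] by simp
qed (auto intro: tensor_eq.intros)

quotient_type (overloaded) ('a, 'b) tensor = "('a::complex_vector \<times> 'b::complex_vector) multiset" / tensor_eq
  by (rule te_equivp)

instantiation tensor :: (complex_vector, complex_vector) complex_vector
begin

lift_definition zero_tensor :: "('a, 'b) tensor" is "{#}" .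
lift_definition plus_tensor :: "('a, 'b) tensor \<Rightarrow> ('a, 'b) tensor \<Rightarrow> ('a, 'b) tensor" is "(+)"
  by (rule te_add2)
lift_definition uminus_tensor :: "('a, 'b) tensor \<Rightarrow> ('a, 'b) tensor"
  is "image_mset (\<lambda>(x, y). (- x, y))" by (rule te_uminus_image)
definition minus_tensor :: "('a, 'b) tensor \<Rightarrow> ('a, 'b) tensor \<Rightarrow> ('a, 'b) tensor"
  where "minus_tensor s t = s + (- t)"
lift_definition scaleC_tensor :: "complex \<Rightarrow> ('a, 'b) tensor \<Rightarrow> ('a, 'b) tensor"
  is "\<lambda>c. image_mset (\<lambda>(x, y). (c *\<^sub>C x, y))" by (rule te_scale_image)

instance
proof
  fix a b d :: "('a, 'b) tensor" and c e :: complex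
  show "a + b + d = a + (b + d)" by transfer (simp add: add.assoc te_refl)
  show "a + b = b + a" by transfer (simp add: add.commute te_refl)
  show "0 + a = a" by transfer (simp add: te_refl)
  show "- a + a = 0"
  proof transfer
    fix M :: "('a \<times> 'b) multiset"
    show "tensor_eq (image_mset (\<lambda>(x, y). (- x, y)) M + M) {#}"
    proof (induction M)
      case (add p M)
      obtain x y where p: "p = (x, y)" by force
      have "tensor_eq {#(- x, y), (x, y)#} {#}"
        using te_trans[OF te_sym[OF te_left[of "- x" x y]], of "{#}"] te_zero[of y] by simp
      from te_add2[OF this add.IH] show ?case by (simp add: p add_mset_commute)
    qed (simp add: te_refl)
  qed
  show "a - b = a + - b" by (rule minus_tensor_def)
  show "c *\<^sub>C (a + b) = c *\<^sub>C a + c *\<^sub>C b" by transfer (simp add: te_refl)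
  show "(c + e) *\<^sub>C a = c *\<^sub>C a + e *\<^sub>C a"
  proof transfer
    fix c e :: complex and M :: "('a \<times> 'b) multiset"
    show "tensor_eq (image_mset (\<lambda>(x, y). ((c + e) *\<^sub>C x, y)) M)
      (image_mset (\<lambda>(x, y). (c *\<^sub>C x, y)) M + image_mset (\<lambda>(x, y). (e *\<^sub>C x, y)) M)"
    proof (induction M)
      case (add p M)
      obtain x y where p: "p = (x, y)" by force
      show ?case using te_add2[OF te_left[of "c *\<^sub>C x" "e *\<^sub>C x" y] add.IH]
        by (simp add: p scaleC_add_left add_mset_commute)
    qed (simp add: te_refl)
  qed
  show "c *\<^sub>C e *\<^sub>C a = (c * e) *\<^sub>C a"
    by transfer (simp add: scaleC_scaleC multiset.map_comp comp_def case_prod_unfold te_refl)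
  show "1 *\<^sub>C a = a" by transfer (simp add: scaleC_one te_refl)
qed

end

lift_definition tens :: "'a::complex_vector \<Rightarrow> 'b::complex_vector \<Rightarrow> ('a, 'b) tensor"
  (infixr \<open>\<otimes>\<close> 72) is "\<lambda>x y. {#(x, y)#}" .

text \<open>If \<open>t = \<Sum>\<^sub>k x\<^sub>k \<otimes> y\<^sub>k\<close>, then \<open>tsum \<beta> t\<close> is \<open>\<Sum>\<^sub>k \<beta> x\<^sub>k y\<^sub>k\<close>. The definition evaluates \<open>\<beta>\<close> on a
  chosen representative; by \<open>tsum_sum\<close> the choice does not matter when \<open>\<beta>\<close> is balanced, which
  covers bilinear maps as well as maps that are antilinear in both arguments.\<close>

definition tsum :: "('a \<Rightarrow> 'b \<Rightarrow> 'c::ab_group_add) \<Rightarrow> ('a::complex_vector, 'b::complex_vector) tensor \<Rightarrow> 'c" where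
  "tsum \<beta> t = (\<Sum>(x, y)\<in>#rep_tensor t. \<beta> x y)"

definition balanced :: "('a::complex_vector \<Rightarrow> 'b::complex_vector \<Rightarrow> 'c::ab_group_add) \<Rightarrow> bool" where
  "balanced \<beta> \<longleftrightarrow> (\<forall>x x' y. \<beta> (x + x') y = \<beta> x y + \<beta> x' y)
    \<and> (\<forall>x y y'. \<beta> x (y + y') = \<beta> x y + \<beta> x y')
    \<and> (\<forall>c x y. \<beta> (c *\<^sub>C x) y = \<beta> x (c *\<^sub>C y))"

lemma te_balanced:
  assumes "balanced \<beta>" "tensor_eq M N"
  shows "(\<Sum>(x, y)\<in>#M. \<beta> x y) = (\<Sum>(x, y)\<in>#N. \<beta> x y)"
proof -
  have z: "\<beta> 0 y = 0" for y
    using assms(1) unfolding balanced_def by (metis add.right_neutral add_cancel_left_right)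
  show ?thesis using assms(2)
    by (induction rule: tensor_eq.induct) (use assms(1) in \<open>auto simp: balanced_def z\<close>)
qed

lemma tsum_abs: "balanced \<beta> \<Longrightarrow> tsum \<beta> (abs_tensor M) = (\<Sum>(x, y)\<in>#M. \<beta> x y)"
  unfolding tsum_def
  by (rule te_balanced) (auto intro: Quotient3_rep_abs[OF Quotient3_tensor] te_refl)

lemma tsum_tens [simp]: "balanced \<beta> \<Longrightarrow> tsum \<beta> (x \<otimes> y) = \<beta> x y"
  by (simp add: tens.abs_eq tsum_abs)

lemma tsum_add: "balanced \<beta> \<Longrightarrow> tsum \<beta> (s + t) = tsum \<beta> s + tsum \<beta> t"
  by (induction s, induction t) (simp add: plus_tensor.abs_eq tsum_abs)

lemma tsum_zero: "balanced \<beta> \<Longrightarrow> tsum \<beta> 0 = 0"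
  by (simp add: zero_tensor.abs_eq tsum_abs)

lemma tsum_sum:
  "balanced \<beta> \<Longrightarrow> tsum \<beta> (sum_list (map (\<lambda>(x, y). x \<otimes> y) zs)) = (\<Sum>(x, y)\<leftarrow>zs. \<beta> x y)"
  by (induction zs) (auto simp: tsum_add tsum_zero)

lemma tensor_representation: "\<exists>zs. t = sum_list (map (\<lambda>(x, y). x \<otimes> y) zs)"
proof (induction t)
  case (1 M)
  show ?case
  proof (induction M)
    case empty
    show ?case by (rule exI[of _ "[]"]) (simp add: zero_tensor_def)
  next
    case (add p M)
    then obtain zs where zs: "abs_tensor M = sum_list (map (\<lambda>(x, y). x \<otimes> y) zs)" by blast
    obtain x y where p: "p = (x, y)" by force
    have "abs_tensor (add_mset p M) = x \<otimes> y + abs_tensor M"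
      by (simp add: p tens.abs_eq plus_tensor.abs_eq)
    then show ?case by (intro exI[of _ "p # zs"]) (simp add: p zs)
  qed
qed

definition tmap :: "('a::complex_vector \<Rightarrow> 'c::complex_vector) \<Rightarrow> ('b::complex_vector \<Rightarrow> 'd::complex_vector)
    \<Rightarrow> ('a, 'b) tensor \<Rightarrow> ('c, 'd) tensor" where
  "tmap f g = tsum (\<lambda>x y. f x \<otimes> g y)"

definition tassoc :: "(('a::complex_vector, 'b::complex_vector) tensor, 'c::complex_vector) tensor
    \<Rightarrow> ('a, ('b, 'c) tensor) tensor" where
  "tassoc = tsum (\<lambda>u z. tsum (\<lambda>x y. x \<otimes> (y \<otimes> z)) u)"

text \<open>The product of a tensor product of algebras. The two products are explicit because the
  algebra of horizontal forms on the affine bundle is a tensor product with a twisted product.\<close>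

definition tmult :: "('a::complex_vector \<Rightarrow> 'a \<Rightarrow> 'a) \<Rightarrow> ('b::complex_vector \<Rightarrow> 'b \<Rightarrow> 'b)
    \<Rightarrow> ('a, 'b) tensor \<Rightarrow> ('a, 'b) tensor \<Rightarrow> ('a, 'b) tensor" where
  "tmult m n s t = tsum (\<lambda>x y. tsum (\<lambda>x' y'. m x x' \<otimes> n y y') t) s"

definition left_part :: "'a::complex_vector set \<Rightarrow> ('a, 'b::complex_vector) tensor set" where
  "left_part W = {t. \<exists>zs. (\<forall>(x, y)\<in>set zs. x \<in> W) \<and> t = sum_list (map (\<lambda>(x, y). x \<otimes> y) zs)}"

section \<open>The tensor algebra of a vector space\<close>

text \<open>Finite formal linear combinations of words, modulo multilinearity. A word of length \<open>n\<close>
  stands for an elementary tensor in the \<open>n\<close>-th tensor power.\<close>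

inductive words_eq ::
  "(complex \<times> 'v::complex_vector list) multiset \<Rightarrow> (complex \<times> 'v list) multiset \<Rightarrow> bool" where
  we_refl: "words_eq M M"
| we_sym: "words_eq M N \<Longrightarrow> words_eq N M"
| we_trans: "words_eq M N \<Longrightarrow> words_eq N K \<Longrightarrow> words_eq M K"
| we_add: "words_eq M N \<Longrightarrow> words_eq (M + K) (N + K)"
| we_coeff: "words_eq {#(c + d, w)#} {#(c, w), (d, w)#}"
| we_zero: "words_eq {#(0, w)#} {#}"
| we_letter: "words_eq {#(c, xs @ (u + v) # ys)#} {#(c, xs @ u # ys), (c, xs @ v # ys)#}"
| we_scale: "words_eq {#(c, xs @ (a *\<^sub>C u) # ys)#} {#(c * a, xs @ u # ys)#}"

lemma we_equivp: "equivp words_eq"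
  by (intro equivpI reflpI sympI transpI) (blast intro: we_refl we_sym we_trans)+

lemma we_add2: "words_eq M N \<Longrightarrow> words_eq K L \<Longrightarrow> words_eq (M + K) (N + L)"
  by (metis we_add we_trans add.commute)

lemma we_scale_image:
  "words_eq M N \<Longrightarrow>
    words_eq (image_mset (\<lambda>(d, w). (c * d, w)) M) (image_mset (\<lambda>(d, w). (c * d, w)) N)"
proof (induction rule: words_eq.induct)
  case (we_scale d xs a u ys)
  show ?case using words_eq.we_scale[of "c * d" xs a u ys] by (simp add: mult.assoc)
qed (auto simp: distrib_left intro: words_eq.intros)

quotient_type (overloaded) 'v tensor_algebra = "(complex \<times> 'v::complex_vector list) multiset" / words_eq
  by (rule we_equivp)

instantiation tensor_algebra :: (complex_vector) complex_vector
begin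

lift_definition zero_tensor_algebra :: "'a tensor_algebra" is "{#}" .
lift_definition plus_tensor_algebra ::
  "'a tensor_algebra \<Rightarrow> 'a tensor_algebra \<Rightarrow> 'a tensor_algebra" is "(+)"
  by (rule we_add2)
lift_definition scaleC_tensor_algebra :: "complex \<Rightarrow> 'a tensor_algebra \<Rightarrow> 'a tensor_algebra"
  is "\<lambda>c. image_mset (\<lambda>(d, w). (c * d, w))" by (rule we_scale_image)
definition uminus_tensor_algebra :: "'a tensor_algebra \<Rightarrow> 'a tensor_algebra"
  where "uminus_tensor_algebra t = (- 1) *\<^sub>C t"
definition minus_tensor_algebra ::
  "'a tensor_algebra \<Rightarrow> 'a tensor_algebra \<Rightarrow> 'a tensor_algebra"
  where "minus_tensor_algebra s t = s + (- t)"

instance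
proof
  fix a b d :: "'a tensor_algebra" and c e :: complex
  show "a + b + d = a + (b + d)" by transfer (simp add: add.assoc we_refl)
  show "a + b = b + a" by transfer (simp add: add.commute we_refl)
  show z: "0 + a = a" by transfer (simp add: we_refl)
  show add: "(c + e) *\<^sub>C a = c *\<^sub>C a + e *\<^sub>C a" for c e
  proof transfer
    fix c e :: complex and M :: "(complex \<times> 'a list) multiset"
    show "words_eq (image_mset (\<lambda>(d, w). ((c + e) * d, w)) M)
      (image_mset (\<lambda>(d, w). (c * d, w)) M + image_mset (\<lambda>(d, w). (e * d, w)) M)"
    proof (induction M)
      case (add p M)
      obtain x y where p: "p = (x, y)" by force
      show ?case using we_add2[OF we_coeff[of "c * x" "e * x" y] add.IH]
        by (simp add: p distrib_right add_mset_commute)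
    qed (simp add: we_refl)
  qed
  show one: "1 *\<^sub>C a = a" by transfer (simp add: we_refl)
  have zero: "0 *\<^sub>C a = 0"
  proof transfer
    fix M :: "(complex \<times> 'a list) multiset"
    show "words_eq (image_mset (\<lambda>(d, w). (0 * d, w)) M) {#}"
    proof (induction M)
      case (add p M)
      obtain x y where p: "p = (x, y)" by force
      show ?case using we_add2[OF we_zero[of y] add.IH] by (simp add: p)
    qed (simp add: we_refl)
  qed
  show "- a + a = 0"
    using add[of "- 1" 1] by (simp add: one zero uminus_tensor_algebra_def)
  show "a - b = a + - b" by (rule minus_tensor_algebra_def)
  show "c *\<^sub>C (a + b) = c *\<^sub>C a + c *\<^sub>C b" by transfer (simp add: we_refl)
  show "c *\<^sub>C e *\<^sub>C a = (c * e) *\<^sub>C a"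
    by transfer (simp add: multiset.map_comp comp_def case_prod_unfold mult.assoc we_refl)
qed

end

lift_definition word :: "'v::complex_vector list \<Rightarrow> 'v tensor_algebra" is "\<lambda>w. {#(1, w)#}" .

text \<open>The linear extension of a function of words, meaningful when the function is multilinear
  in the letters (lemma \<open>wsum_word\<close>).\<close>

definition wsum :: "('v list \<Rightarrow> 'c::complex_vector) \<Rightarrow> 'v::complex_vector tensor_algebra \<Rightarrow> 'c" where
  "wsum g t = (\<Sum>(c, w)\<in>#rep_tensor_algebra t. c *\<^sub>C g w)"

definition multilinear :: "('v::complex_vector list \<Rightarrow> 'c::complex_vector) \<Rightarrow> bool" where
  "multilinear g \<longleftrightarrow> (\<forall>xs ys. clinear (\<lambda>u. g (xs @ u # ys)))"

lemma we_multilinear: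
  assumes "multilinear g" "words_eq M N"
  shows "(\<Sum>(c, w)\<in>#M. c *\<^sub>C g w) = (\<Sum>(c, w)\<in>#N. c *\<^sub>C g w)"
  using assms(2)
  by (induction rule: words_eq.induct)
    (use assms(1) in \<open>auto simp: multilinear_def clinear_def scaleC_add_left scaleC_add_right
       scaleC_scaleC scaleC_zero_left\<close>)

lemma wsum_abs: "multilinear g \<Longrightarrow> wsum g (abs_tensor_algebra M) = (\<Sum>(c, w)\<in>#M. c *\<^sub>C g w)"
  unfolding wsum_def
  by (rule we_multilinear) (auto intro: Quotient3_rep_abs[OF Quotient3_tensor_algebra] we_refl)

lemma wsum_word [simp]: "multilinear g \<Longrightarrow> wsum g (word w) = g w"
  by (simp add: word.abs_eq wsum_abs scaleC_one)

lemma wsum_add: "multilinear g \<Longrightarrow> wsum g (s + t) = wsum g s + wsum g t"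
  by (induction s, induction t) (simp add: plus_tensor_algebra.abs_eq wsum_abs)

section \<open>Hopf star-algebras and compact matrix quantum groups\<close>

locale hopf_star_algebra =
  fixes comult :: "'a::complex_star_algebra \<Rightarrow> ('a, 'a) tensor"
    and counit :: "'a \<Rightarrow> complex"
    and antipode :: "'a \<Rightarrow> 'a"
  assumes comult_linear: "clinear comult"
    and comult_one: "comult 1 = 1 \<otimes> 1"
    and comult_mult: "comult (a * b) = tmult (*) (*) (comult a) (comult b)"
    and comult_star: "comult (star a) = tmap star star (comult a)"
    and coassoc: "tassoc (tmap comult id (comult a)) = tmap id comult (comult a)"
    and counit_hom: "alg_hom counit"
    and counit_left: "tsum (\<lambda>x y. counit x *\<^sub>C y) (comult a) = a"
    and counit_right: "tsum (\<lambda>x y. counit y *\<^sub>C x) (comult a) = a"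
    and antipode_linear: "clinear antipode"
    and antipode_left: "tsum (\<lambda>x y. antipode x * y) (comult a) = counit a *\<^sub>C 1"
    and antipode_right: "tsum (\<lambda>x y. x * antipode y) (comult a) = counit a *\<^sub>C 1"

inductive_set star_alg_generated :: "'a::complex_star_algebra set \<Rightarrow> 'a set" for X where
  gen: "x \<in> X \<Longrightarrow> x \<in> star_alg_generated X"
| one: "1 \<in> star_alg_generated X"
| add: "x \<in> star_alg_generated X \<Longrightarrow> y \<in> star_alg_generated X \<Longrightarrow> x + y \<in> star_alg_generated X"
| scale: "x \<in> star_alg_generated X \<Longrightarrow> c *\<^sub>C x \<in> star_alg_generated X"
| mult: "x \<in> star_alg_generated X \<Longrightarrow> y \<in> star_alg_generated X \<Longrightarrow> x * y \<in> star_alg_generated X"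
| star: "x \<in> star_alg_generated X \<Longrightarrow> star x \<in> star_alg_generated X"

text \<open>The polynomial functions on a compact matrix quantum group: a Hopf star-algebra generated,
  as a star-algebra, by the entries of one unitary matrix corepresentation \<open>u\<close>. The underlying
  C*-algebra, a completion of this algebra, plays no role.\<close>

locale compact_matrix_quantum_group = hopf_star_algebra comult counit antipode
  for comult :: "'a::complex_star_algebra \<Rightarrow> ('a, 'a) tensor" and counit antipode +
  assumes fundamental_representation:
    "\<exists>(n::nat) (u :: nat \<Rightarrow> nat \<Rightarrow> 'a).
       (\<forall>i<n. \<forall>j<n. comult (u i j) = (\<Sum>k<n. u i k \<otimes> u k j)) \<and>
       (\<forall>i<n. \<forall>j<n. counit (u i j) = (if i = j then 1 else 0)) \<and>
       (\<forall>i<n. \<forall>j<n. (\<Sum>k<n. star (u k i) * u k j) = (if i = j then 1 else 0)) \<and>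
       (\<forall>i<n. \<forall>j<n. (\<Sum>k<n. u i k * star (u j k)) = (if i = j then 1 else 0)) \<and>
       star_alg_generated {u i j |i j. i < n \<and> j < n} = UNIV"

section \<open>Bicovariant star-bimodules and their left-invariant elements\<close>

locale bicovariant_star_bimodule = hopf_star_algebra comult counit antipode
  for comult :: "'a::complex_star_algebra \<Rightarrow> ('a, 'a) tensor" and counit antipode +
  fixes lact :: "'a \<Rightarrow> 'p::complex_star_vector \<Rightarrow> 'p"
    and ract :: "'p \<Rightarrow> 'a \<Rightarrow> 'p"
    and lcoact :: "'p \<Rightarrow> ('a, 'p) tensor"
    and rcoact :: "'p \<Rightarrow> ('p, 'a) tensor"
  assumes lact_bilinear: "cbilinear lact"
    and lact_one: "lact 1 p = p"
    and lact_mult: "lact (a * b) p = lact a (lact b p)"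
    and ract_bilinear: "cbilinear ract"
    and ract_one: "ract p 1 = p"
    and ract_mult: "ract p (a * b) = ract (ract p a) b"
    and lact_ract: "ract (lact a p) b = lact a (ract p b)"
    and star_lact: "star (lact a p) = ract (star p) (star a)"
    and star_ract: "star (ract p a) = lact (star a) (star p)"
    and lcoact_linear: "clinear lcoact"
    and lcoact_coassoc: "tassoc (tmap comult id (lcoact p)) = tmap id lcoact (lcoact p)"
    and lcoact_counit: "tsum (\<lambda>a p'. counit a *\<^sub>C p') (lcoact p) = p"
    and lcoact_lact: "lcoact (lact a p) =
          tsum (\<lambda>a1 a2. tsum (\<lambda>b p'. (a1 * b) \<otimes> lact a2 p') (lcoact p)) (comult a)"
    and lcoact_ract: "lcoact (ract p a) =
          tsum (\<lambda>b p'. tsum (\<lambda>a1 a2. (b * a1) \<otimes> ract p' a2) (comult a)) (lcoact p)"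
    and lcoact_star: "lcoact (star p) = tmap star star (lcoact p)"
    and rcoact_linear: "clinear rcoact"
    and rcoact_coassoc: "tassoc (tmap rcoact id (rcoact p)) = tmap id comult (rcoact p)"
    and rcoact_counit: "tsum (\<lambda>p' a. counit a *\<^sub>C p') (rcoact p) = p"
    and rcoact_lact: "rcoact (lact a p) =
          tsum (\<lambda>a1 a2. tsum (\<lambda>p' b. lact a1 p' \<otimes> (a2 * b)) (rcoact p)) (comult a)"
    and rcoact_ract: "rcoact (ract p a) =
          tsum (\<lambda>p' b. tsum (\<lambda>a1 a2. ract p' a1 \<otimes> (b * a2)) (comult a)) (rcoact p)"
    and rcoact_star: "rcoact (star p) = tmap star star (rcoact p)"
    and bicovariance: "tassoc (tmap lcoact id (rcoact p)) = tmap id rcoact (lcoact p)"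

text \<open>The space of left-invariant elements is represented by a type \<open>'v\<close> with an embedding \<open>incl\<close>
  into the bimodule; \<open>coactV\<close> is the restricted right coaction and \<open>actV \<theta> a\<close> is \<open>\<theta> \<circ> a\<close>.\<close>

locale left_invariant_space =
  bicovariant_star_bimodule comult counit antipode lact ract lcoact rcoact
  for comult :: "'a::complex_star_algebra \<Rightarrow> ('a, 'a) tensor" and counit antipode
    and lact :: "'a \<Rightarrow> 'p::complex_star_vector \<Rightarrow> 'p" and ract lcoact rcoact +
  fixes incl :: "'v::complex_star_vector \<Rightarrow> 'p"
    and coactV :: "'v \<Rightarrow> ('v, 'a) tensor"
    and actV :: "'v \<Rightarrow> 'a \<Rightarrow> 'v"
  assumes incl_linear: "clinear incl"
    and incl_inj: "inj incl"
    and incl_range: "range incl = {p. lcoact p = 1 \<otimes> p}"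
    and incl_star: "incl (star \<theta>) = star (incl \<theta>)"
    and coactV_linear: "clinear coactV"
    and coactV_eq: "tmap incl id (coactV \<theta>) = rcoact (incl \<theta>)"
    and actV_eq: "incl (actV \<theta> a) = tsum (\<lambda>a1 a2. ract (lact (antipode a1) (incl \<theta>)) a2) (comult a)"

section \<open>The braided symmetric algebra\<close>

text \<open>\<open>braid_at coactV actV i\<close> applies \<open>\<tau>\<close>, where \<open>\<tau> (\<eta> \<otimes> \<theta>) = \<Sum>\<^sub>k \<theta>\<^sub>k \<otimes> (\<eta> \<circ> c\<^sub>k)\<close>, to the tensor
  factors \<open>i\<close> and \<open>i + 1\<close> (counted from \<open>0\<close>). It is used only on words of length \<open>> i + 1\<close>.\<close>

definition braid_at :: "('v \<Rightarrow> ('v, 'a::complex_vector) tensor) \<Rightarrow> ('v \<Rightarrow> 'a \<Rightarrow> 'v) \<Rightarrow> nat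
    \<Rightarrow> 'v::complex_vector tensor_algebra \<Rightarrow> 'v tensor_algebra" where
  "braid_at coactV actV i = wsum (\<lambda>w.
     if i + 1 < length w
     then tsum (\<lambda>\<theta> c. word (take i w @ [\<theta>, actV (w ! i) c] @ drop (i + 2) w)) (coactV (w ! (i + 1)))
     else 0)"

definition adjacent_product :: "nat list \<Rightarrow> nat \<Rightarrow> nat" where
  "adjacent_product is = foldr (\<lambda>i f. transpose i (i + 1) \<circ> f) is id"

definition minimal_decomposition :: "nat \<Rightarrow> (nat \<Rightarrow> nat) \<Rightarrow> nat list \<Rightarrow> bool" where
  "minimal_decomposition n \<pi> is \<longleftrightarrow>
     (\<forall>i\<in>set is. i + 1 < n) \<and> adjacent_product is = \<pi> \<and>
     (\<forall>js. (\<forall>j\<in>set js. j + 1 < n) \<and> adjacent_product js = \<pi> \<longrightarrow> length is \<le> length js)"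

text \<open>By the braid equation for \<open>\<tau>\<close>, the operator is the same for all minimal decompositions.\<close>

definition braid_perm :: "('v \<Rightarrow> ('v, 'a::complex_vector) tensor) \<Rightarrow> ('v \<Rightarrow> 'a \<Rightarrow> 'v) \<Rightarrow> nat
    \<Rightarrow> (nat \<Rightarrow> nat) \<Rightarrow> 'v::complex_vector tensor_algebra \<Rightarrow> 'v tensor_algebra" where
  "braid_perm coactV actV n \<pi> =
     foldr (\<lambda>i f. braid_at coactV actV i \<circ> f) (SOME is. minimal_decomposition n \<pi> is) id"

definition braided_symmetrizer :: "('v \<Rightarrow> ('v, 'a::complex_vector) tensor) \<Rightarrow> ('v \<Rightarrow> 'a \<Rightarrow> 'v)
    \<Rightarrow> 'v::complex_vector tensor_algebra \<Rightarrow> 'v tensor_algebra" where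
  "braided_symmetrizer coactV actV =
     wsum (\<lambda>w. \<Sum>\<pi> | \<pi> permutes {..<length w}. braid_perm coactV actV (length w) \<pi> (word w))"

text \<open>The algebra \<open>S(V)\<close>, a type \<open>'s\<close> generated by the image of \<open>inV\<close>: the canonical map from the
  tensor algebra is onto and its kernel is that of the symmetrizer. \<open>coactS\<close> and \<open>actS\<close> are the
  extensions of \<open>coactV\<close> and \<open>actV\<close>.\<close>

locale braided_symmetric_algebra =
  left_invariant_space comult counit antipode lact ract lcoact rcoact incl coactV actV
  for comult :: "'a::complex_star_algebra \<Rightarrow> ('a, 'a) tensor" and counit antipode
    and lact :: "'a \<Rightarrow> 'p::complex_star_vector \<Rightarrow> 'p" and ract lcoact rcoact
    and incl :: "'v::complex_star_vector \<Rightarrow> 'p" and coactV actV +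
  fixes inV :: "'v \<Rightarrow> 's::complex_star_algebra"
    and coactS :: "'s \<Rightarrow> ('s, 'a) tensor"
    and actS :: "'s \<Rightarrow> 'a \<Rightarrow> 's"
  assumes inV_linear: "clinear inV"
    and inV_star: "inV (star \<theta>) = star (inV \<theta>)"
    and symmetric_surj: "surj (wsum (\<lambda>w. prod_list (map inV w)))"
    and symmetric_kernel: "wsum (\<lambda>w. prod_list (map inV w)) t = 0
          \<longleftrightarrow> braided_symmetrizer coactV actV t = 0"
    and coactS_linear: "clinear coactS"
    and coactS_one: "coactS 1 = 1 \<otimes> 1"
    and coactS_mult: "coactS (s * t') = tmult (*) (*) (coactS s) (coactS t')"
    and coactS_inV: "coactS (inV \<theta>) = tmap inV id (coactV \<theta>)"
    and actS_bilinear: "cbilinear actS"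
    and actS_one: "actS 1 a = counit a *\<^sub>C 1"
    and actS_mult: "actS (s * t') a = tsum (\<lambda>a1 a2. actS s a1 * actS t' a2) (comult a)"
    and actS_inV: "actS (inV \<theta>) a = inV (actV \<theta> a)"

section \<open>The affine extension of the quantum group\<close>

text \<open>The Hopf star-algebra generated by the images of \<open>inA\<close> and \<open>inS\<close>; \<open>coactE\<close> is its coproduct
  restricted to the braided symmetric algebra.\<close>

locale affine_extension =
  braided_symmetric_algebra comult counit antipode lact ract lcoact rcoact incl coactV actV
    inV coactS actS +
  ext: hopf_star_algebra comultE counitE antipodeE
  for comult :: "'a::complex_star_algebra \<Rightarrow> ('a, 'a) tensor" and counit antipode
    and lact :: "'a \<Rightarrow> 'p::complex_star_vector \<Rightarrow> 'p" and ract lcoact rcoact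
    and incl :: "'v::complex_star_vector \<Rightarrow> 'p" and coactV actV
    and inV :: "'v \<Rightarrow> 's::complex_star_algebra" and coactS actS
    and comultE :: "'t::complex_star_algebra \<Rightarrow> ('t, 't) tensor" and counitE antipodeE +
  fixes inA :: "'a \<Rightarrow> 't"
    and inS :: "'s \<Rightarrow> 't"
    and coactE :: "'s \<Rightarrow> ('s, 't) tensor"
  assumes inA_hom: "alg_hom inA"
    and inA_star: "inA (star a) = star (inA a)"
    and inA_comult: "comultE (inA a) = tmap inA inA (comult a)"
    and inA_counit: "counitE (inA a) = counit a"
    and inA_antipode: "antipodeE (inA a) = inA (antipode a)"
    and inS_hom: "alg_hom inS"
    and inS_star: "inS (star s) = star (inS s)"
    and cross_relation: "inS (inV \<theta>) * inA a
          = tsum (\<lambda>a1 a2. inA a1 * inS (inV (actV \<theta> a2))) (comult a)"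
    and decomposition: "bij (tsum (\<lambda>a s. inA a * inS s))"
    and comultE_inV: "comultE (inS (inV \<theta>))
          = 1 \<otimes> inS (inV \<theta>) + tmap (inS \<circ> inV) inA (coactV \<theta>)"
    and counitE_inV: "counitE (inS (inV \<theta>)) = 0"
    and antipodeE_inV: "antipodeE (inS (inV \<theta>))
          = - tsum (\<lambda>\<theta>' c. inS (inV \<theta>') * inA (antipode c)) (coactV \<theta>)"
    and coactE_linear: "clinear coactE"
    and coactE_eq: "tmap inS id (coactE s) = comultE (inS s)"

section \<open>Quantum principal bundles and horizontal forms\<close>

definition coinvariants ::
    "('x::complex_vector \<Rightarrow> ('x, 'a::complex_algebra_1) tensor) \<Rightarrow> 'x set" where
  "coinvariants F = {x. F x = x \<otimes> 1}"

text \<open>The canonical map on the tensor product balanced over \<open>coinvariants F\<close> is surjective if and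
  only if its composition with the quotient map, defined on the full tensor product, is.\<close>

locale quantum_principal_bundle = compact_matrix_quantum_group comult counit antipode
  for comult :: "'a::complex_star_algebra \<Rightarrow> ('a, 'a) tensor" and counit antipode +
  fixes F :: "'b::complex_star_algebra \<Rightarrow> ('b, 'a) tensor"
  assumes F_linear: "clinear F"
    and F_one: "F 1 = 1 \<otimes> 1"
    and F_mult: "F (b * b') = tmult (*) (*) (F b) (F b')"
    and F_star: "F (star b) = tmap star star (F b)"
    and F_coassoc: "tassoc (tmap F id (F b)) = tmap id comult (F b)"
    and F_counit: "tsum (\<lambda>b' a. counit a *\<^sub>C b') (F b) = b"
    and canonical_map_surj: "surj (tsum (\<lambda>q b. tmult (*) (*) (q \<otimes> 1) (F b)))"

definition graded_by :: "(nat \<Rightarrow> 'h::complex_vector set) \<Rightarrow> bool" where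
  "graded_by deg \<longleftrightarrow> (\<forall>k. csubspace (deg k)) \<and>
     (\<forall>x. \<exists>!f. (\<forall>k. f k \<in> deg k) \<and> finite {k. f k \<noteq> 0} \<and> x = (\<Sum>k | f k \<noteq> 0. f k))"

text \<open>First-order antiderivations of the graded subalgebra \<open>C\<close> of an algebra with product \<open>m\<close>.\<close>

definition antiderivation_on :: "'x set \<Rightarrow> ('x \<Rightarrow> 'x \<Rightarrow> 'x) \<Rightarrow> (nat \<Rightarrow> 'x set)
    \<Rightarrow> ('x::complex_vector \<Rightarrow> 'x) \<Rightarrow> bool" where
  "antiderivation_on C m deg D \<longleftrightarrow>
     (\<forall>x\<in>C. D x \<in> C) \<and>
     (\<forall>x\<in>C. \<forall>y\<in>C. D (x + y) = D x + D y) \<and>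
     (\<forall>c. \<forall>x\<in>C. D (c *\<^sub>C x) = c *\<^sub>C D x) \<and>
     (\<forall>k. \<forall>x\<in>C \<inter> deg k. D x \<in> deg (k + 1)) \<and>
     (\<forall>k. \<forall>x\<in>C \<inter> deg k. \<forall>y\<in>C. D (m x y) = m (D x) y + (- 1) ^ k *\<^sub>C m x (D y))"

text \<open>\<open>inB\<close> identifies the bundle algebra with the forms of degree \<open>0\<close>. The counit axiom for \<open>Fh\<close>
  is part of \<open>Fh\<close> being a coaction; it is what makes \<open>1 \<otimes> 1\<close> the unit for the product \<open>hmult\<close>
  below. \<open>dM\<close> is only relevant on \<open>coinvariants Fh\<close>, the differential forms on the base.\<close>

locale horizontal_forms = quantum_principal_bundle comult counit antipode F
  for comult :: "'a::complex_star_algebra \<Rightarrow> ('a, 'a) tensor" and counit antipode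
    and F :: "'b::complex_star_algebra \<Rightarrow> ('b, 'a) tensor" +
  fixes deg :: "nat \<Rightarrow> 'h::{complex_algebra_1, complex_star_vector} set"
    and inB :: "'b \<Rightarrow> 'h"
    and Fh :: "'h \<Rightarrow> ('h, 'a) tensor"
    and dM :: "'h \<Rightarrow> 'h"
  assumes deg_graded: "graded_by deg"
    and deg_mult: "x \<in> deg k \<Longrightarrow> y \<in> deg l \<Longrightarrow> x * y \<in> deg (k + l)"
    and deg_star: "x \<in> deg k \<Longrightarrow> star x \<in> deg k"
    and star_graded: "x \<in> deg k \<Longrightarrow> y \<in> deg l \<Longrightarrow> star (x * y) = (- 1) ^ (k * l) *\<^sub>C (star y * star x)"
    and inB_hom: "alg_hom inB"
    and inB_star: "inB (star b) = star (inB b)"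
    and inB_inj: "inj inB"
    and inB_range: "range inB = deg 0"
    and Fh_linear: "clinear Fh"
    and Fh_one: "Fh 1 = 1 \<otimes> 1"
    and Fh_mult: "Fh (x * y) = tmult (*) (*) (Fh x) (Fh y)"
    and Fh_star: "Fh (star x) = tmap star star (Fh x)"
    and Fh_coassoc: "tassoc (tmap Fh id (Fh x)) = tmap id comult (Fh x)"
    and Fh_counit: "tsum (\<lambda>x' a. counit a *\<^sub>C x') (Fh x) = x"
    and Fh_deg: "x \<in> deg k \<Longrightarrow> Fh x \<in> left_part (deg k)"
    and Fh_inB: "Fh (inB b) = tmap inB id (F b)"
    and dM_antiderivation: "antiderivation_on (coinvariants Fh) (*) deg dM"
    and dM_square: "x \<in> coinvariants Fh \<Longrightarrow> dM (dM x) = 0"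
    and dM_star: "x \<in> coinvariants Fh \<Longrightarrow> dM (star x) = star (dM x)"
    and antiderivation_exists:
      "\<exists>D. antiderivation_on UNIV (*) deg D \<and> (\<forall>x. D (star x) = star (D x)) \<and>
           (\<forall>x. Fh (D x) = tmap D id (Fh x)) \<and> (\<forall>x\<in>coinvariants Fh. D x = dM x)"

section \<open>Horizontal forms on the affine bundle\<close>

definition hmult :: "('h::complex_algebra_1 \<Rightarrow> ('h, 'a::complex_vector) tensor)
    \<Rightarrow> ('s::complex_algebra_1 \<Rightarrow> 'a \<Rightarrow> 's) \<Rightarrow> ('h, 's) tensor \<Rightarrow> ('h, 's) tensor \<Rightarrow> ('h, 's) tensor" where
  "hmult Fh actS u w =
     tsum (\<lambda>\<psi> \<theta>. tsum (\<lambda>\<phi> \<eta>. tsum (\<lambda>\<phi>' c. (\<psi> * \<phi>') \<otimes> (actS \<theta> c * \<eta>)) (Fh \<phi>)) w) u"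

definition hstar :: "('h::complex_star_vector \<Rightarrow> ('h, 'a::complex_star_vector) tensor)
    \<Rightarrow> ('s::complex_star_vector \<Rightarrow> 'a \<Rightarrow> 's) \<Rightarrow> ('h, 's) tensor \<Rightarrow> ('h, 's) tensor" where
  "hstar Fh actS = tsum (\<lambda>\<phi> \<theta>. tsum (\<lambda>\<phi>' c. star \<phi>' \<otimes> actS (star \<theta>) (star c)) (Fh \<phi>))"

locale affine_bundle =
  horizontal_forms comult counit antipode F deg inB Fh dM +
  affine_extension comult counit antipode lact ract lcoact rcoact incl coactV actV
    inV coactS actS comultE counitE antipodeE inA inS coactE
  for comult :: "'a::complex_star_algebra \<Rightarrow> ('a, 'a) tensor" and counit antipode
    and F :: "'b::complex_star_algebra \<Rightarrow> ('b, 'a) tensor"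
    and deg :: "nat \<Rightarrow> 'h::{complex_algebra_1, complex_star_vector} set" and inB Fh dM
    and lact :: "'a \<Rightarrow> 'p::complex_star_vector \<Rightarrow> 'p" and ract lcoact rcoact
    and incl :: "'v::complex_star_vector \<Rightarrow> 'p" and coactV actV
    and inV :: "'v \<Rightarrow> 's::complex_star_algebra" and coactS actS
    and comultE :: "'t::complex_star_algebra \<Rightarrow> ('t, 't) tensor" and counitE antipodeE
    and inA inS coactE +
  fixes H :: "('h, 's) tensor \<Rightarrow> (('h, 's) tensor, 't) tensor"
  assumes H_linear: "clinear H"
    and H_mult: "H (hmult Fh actS u w) = tmult (hmult Fh actS) (*) (H u) (H w)"
    and H_star: "H (hstar Fh actS u) = tmap (hstar Fh actS) star (H u)"
    and H_horizontal: "H (\<phi> \<otimes> 1) = tmap (\<lambda>\<psi>. \<psi> \<otimes> 1) inA (Fh \<phi>)"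
    and H_symmetric: "H (1 \<otimes> s) = tmap (\<lambda>s'. 1 \<otimes> s') id (coactE s)"

text \<open>Membership in \<open>der\<close> of the affine bundle.\<close>

definition affine_bundle_derivative ::
    "(nat \<Rightarrow> 'h::{complex_algebra_1, complex_star_vector} set)
      \<Rightarrow> ('h \<Rightarrow> ('h, 'a::complex_star_algebra) tensor) \<Rightarrow> ('h \<Rightarrow> 'h)
      \<Rightarrow> ('s::complex_star_algebra \<Rightarrow> 'a \<Rightarrow> 's)
      \<Rightarrow> (('h, 's) tensor \<Rightarrow> (('h, 's) tensor, 't::complex_star_algebra) tensor)
      \<Rightarrow> (('h, 's) tensor \<Rightarrow> ('h, 's) tensor) \<Rightarrow> bool" where
  "affine_bundle_derivative deg Fh dM actS H D \<longleftrightarrow>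
     antiderivation_on UNIV (hmult Fh actS) (\<lambda>k. left_part (deg k)) D \<and>
     (\<forall>u. D (hstar Fh actS u) = hstar Fh actS (D u)) \<and>
     (\<forall>u. H (D u) = tmap D id (H u)) \<and>
     (\<forall>\<phi>\<in>coinvariants Fh. D (\<phi> \<otimes> 1) = dM \<phi> \<otimes> 1)"

text \<open>\<open>\<rho>\<close> is the curvature of \<open>D\<close> with respect to a coaction \<open>\<delta>\<close> on an algebra with product \<open>m\<close>.\<close>

definition is_curvature :: "('x \<Rightarrow> 'x \<Rightarrow> 'x) \<Rightarrow> ('x \<Rightarrow> ('x, 'c) tensor) \<Rightarrow> ('x \<Rightarrow> 'x)
    \<Rightarrow> ('c::complex_vector \<Rightarrow> 'x::complex_vector) \<Rightarrow> bool" where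
  "is_curvature m \<delta> D \<rho> \<longleftrightarrow> clinear \<rho> \<and> (\<forall>x. D (D x) = - tsum (\<lambda>x' c. m x' (\<rho> c)) (\<delta> x))"

end

theory Submission
  imports Defs
begin

text \<open>The formula is obtained by evaluating the curvature identity on \<open>1 \<otimes> \<theta>\<close>: its \<open>H\<close>-image is
  \<open>(1 \<otimes> 1) \<otimes> \<theta> + \<Sum>\<^sub>k (1 \<otimes> \<theta>\<^sub>k) \<otimes> c\<^sub>k\<close>, and \<open>D\<^sup>2 \<theta> = D \<lambda>(\<theta>)\<close>. That \<open>\<rho>\<close> maps \<open>\<A>\<close> into
  horizontal forms on the original bundle follows from the surjectivity of the canonical map: if
  \<open>1 \<otimes> a = \<Sum>\<^sub>i (q\<^sub>i \<otimes> 1) F(b\<^sub>i)\<close>, then \<open>\<rho>(a) = - \<Sum>\<^sub>i q\<^sub>i D\<^sup>2(b\<^sub>i)\<close>.\<close>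

section \<open>Linear and bilinear maps\<close>

lemma clinearI:
  "(\<And>x y. f (x + y) = f x + f y) \<Longrightarrow> (\<And>c x. f (c *\<^sub>C x) = c *\<^sub>C f x) \<Longrightarrow> clinear f"
  by (simp add: clinear_def)

lemma clinear_add: "clinear f \<Longrightarrow> f (x + y) = f x + f y"
  by (simp add: clinear_def)

lemma clinear_scaleC: "clinear f \<Longrightarrow> f (c *\<^sub>C x) = c *\<^sub>C f x"
  by (simp add: clinear_def)

lemma clinear_zero: "clinear f \<Longrightarrow> f 0 = 0"
  using clinear_add[of f 0 0] by simp

lemma clinear_minus: "clinear f \<Longrightarrow> f (- x) = - f x"
  using clinear_add[of f "- x" x] by (simp add: clinear_zero eq_neg_iff_add_eq_0)

lemma clinear_compose: "clinear f \<Longrightarrow> clinear g \<Longrightarrow> clinear (\<lambda>x. f (g x))"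
  by (simp add: clinear_def)

lemma clinear_id: "clinear id" "clinear (\<lambda>x. x)"
  by (simp_all add: clinear_def)

lemma clinear_sum_mset: "clinear f \<Longrightarrow> f (\<Sum>x\<in>#M. g x) = (\<Sum>x\<in>#M. f (g x))"
  by (induction M) (simp_all add: clinear_zero clinear_add)

lemma scaleC_sum_mset:
  "c *\<^sub>C (\<Sum>x\<in>#M. g x) = (\<Sum>x\<in>#M. c *\<^sub>C (g x :: 'a::complex_vector))"
  by (induction M) (simp_all add: scaleC_zero_right scaleC_add_right)

lemma cbilinearI:
  "(\<And>x. clinear (\<beta> x)) \<Longrightarrow> (\<And>y. clinear (\<lambda>x. \<beta> x y)) \<Longrightarrow> cbilinear \<beta>"
  by (simp add: cbilinear_def)

lemma cbilinearD: "cbilinear \<beta> \<Longrightarrow> clinear (\<beta> x)" "cbilinear \<beta> \<Longrightarrow> clinear (\<lambda>x. \<beta> x y)"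
  by (simp_all add: cbilinear_def)

lemma cbilinear_balanced: "cbilinear \<beta> \<Longrightarrow> balanced \<beta>"
  by (simp add: cbilinear_def clinear_def balanced_def)

lemma cbilinear_compose:
  "cbilinear \<beta> \<Longrightarrow> clinear f \<Longrightarrow> clinear g \<Longrightarrow> cbilinear (\<lambda>x y. \<beta> (f x) (g y))"
  by (simp add: cbilinear_def clinear_def)

lemma cbilinear_mult: "cbilinear ((*) :: 'a::complex_algebra_1 \<Rightarrow> 'a \<Rightarrow> 'a)"
  by (simp add: cbilinear_def clinear_def distrib_left distrib_right
      mult_scaleC_left mult_scaleC_right)

lemma cbilinear_scaleC:
  "cbilinear (\<lambda>z (x :: 'a::complex_vector). z *\<^sub>C x)" "cbilinear (\<lambda>(x :: 'a) z. z *\<^sub>C x)"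
  by (simp_all add: cbilinear_def clinear_def scaleC_add_left scaleC_add_right scaleC_scaleC
      scaleC_complex_def mult.commute)

section \<open>Linear calculus of \<open>tsum\<close> and \<open>tmap\<close> on tensor
  products\<close>

lemma tens_add_left: "(x + x') \<otimes> y = x \<otimes> y + x' \<otimes> y"
  by transfer (simp add: te_left add_mset_commute)

lemma tens_add_right: "x \<otimes> (y + y') = x \<otimes> y + x \<otimes> y'"
  by transfer (simp add: te_right add_mset_commute)

lemma tens_scaleC_left: "(c *\<^sub>C x) \<otimes> y = c *\<^sub>C (x \<otimes> y)"
  by transfer (simp add: te_refl)

lemma tens_scaleC_right: "x \<otimes> (c *\<^sub>C y) = c *\<^sub>C (x \<otimes> y)"
  by transfer (simp add: te_scale te_sym)

lemma cbilinear_tens: "cbilinear (\<otimes>)"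
  by (intro cbilinearI clinearI)
    (simp_all add: tens_add_left tens_add_right tens_scaleC_left tens_scaleC_right)

lemma tensor_induct [case_names tens add]:
  assumes "\<And>x y. P (x \<otimes> y)" and "\<And>s t. P s \<Longrightarrow> P t \<Longrightarrow> P (s + t)"
  shows "P t"
proof -
  obtain zs where t: "t = sum_list (map (\<lambda>(x, y). x \<otimes> y) zs)"
    using tensor_representation by blast
  \<comment> \<open>The zero tensor is itself elementary, namely 0 \<otimes> 0, so the empty sum
    needs no separate case in the induction rule.\<close>
  have "P 0"
    using assms(1)[of 0 0] by (simp add: clinear_zero[OF cbilinearD(1)[OF cbilinear_tens]])
  then show ?thesis
    unfolding t by (induction zs) (auto intro: assms)
qed

text \<open>A balanced map yields additivity only. Homogeneity uses bilinearity: on an elementary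
  tensor the scalar is moved into the first factor and then pulled out of
  \<open>\<beta>\<close>.\<close>

lemma clinear_tsum:
  assumes "cbilinear \<beta>"
  shows "clinear (tsum \<beta>)"
proof (rule clinearI)
  note b = cbilinear_balanced[OF assms]
  show "tsum \<beta> (s + t) = tsum \<beta> s + tsum \<beta> t" for s t
    by (rule tsum_add[OF b])
  show "tsum \<beta> (c *\<^sub>C t) = c *\<^sub>C tsum \<beta> t" for c t
  proof (induction t rule: tensor_induct)
    case (tens x y)
    show ?case
      by (simp add: tens_scaleC_left[symmetric] b clinear_scaleC[OF cbilinearD(2)[OF assms]])
  qed (simp add: scaleC_add_right tsum_add[OF b])
qed

text \<open>With \<open>t\<close> fixed, \<open>tsum\<close> is a finite sum over one fixed
  representative of \<open>t\<close>, hence linear in whatever its summands depend on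
  linearly.\<close>

lemma clinear_tsum_parameter:
  assumes "\<And>x y. clinear (\<lambda>p. \<beta> p x y)"
  shows "clinear (\<lambda>p. tsum (\<beta> p) t)"
  unfolding tsum_def
  by (rule clinearI)
    (simp_all add: case_prod_unfold clinear_add[OF assms] clinear_scaleC[OF assms]
      sum_mset.distrib scaleC_sum_mset)

text \<open>Both sides sum over the same representative of \<open>t\<close>, so
  \<open>\<beta>\<close> may be arbitrary.\<close>

lemma clinear_apply_tsum: "clinear f \<Longrightarrow> f (tsum \<beta> t) = tsum (\<lambda>x y. f (\<beta> x y)) t"
  by (simp add: tsum_def clinear_sum_mset case_prod_unfold)

lemma cbilinear_tmap: "clinear f \<Longrightarrow> clinear g \<Longrightarrow> cbilinear (\<lambda>x y. f x \<otimes> g y)"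
  by (rule cbilinear_compose[OF cbilinear_tens])

lemma tmap_tens: "clinear f \<Longrightarrow> clinear g \<Longrightarrow> tmap f g (x \<otimes> y) = f x \<otimes> g y"
  by (simp add: tmap_def cbilinear_balanced cbilinear_tmap)

lemma clinear_tmap: "clinear f \<Longrightarrow> clinear g \<Longrightarrow> clinear (tmap f g)"
  unfolding tmap_def by (intro clinear_tsum cbilinear_tmap)

lemma tsum_tmap:
  assumes "cbilinear \<beta>" "clinear f" "clinear g"
  shows "tsum \<beta> (tmap f g t) = tsum (\<lambda>x y. \<beta> (f x) (g y)) t"
  unfolding tmap_def clinear_apply_tsum[OF clinear_tsum[OF assms(1)]]
  by (simp add: cbilinear_balanced[OF assms(1)])

lemma tmap_tmap:
  "clinear f \<Longrightarrow> clinear g \<Longrightarrow> clinear f' \<Longrightarrow> clinear g' \<Longrightarrow>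
    tmap f' g' (tmap f g t) = tmap (\<lambda>x. f' (f x)) (\<lambda>y. g' (g y)) t"
  unfolding tmap_def[of f' g'] by (simp add: tsum_tmap cbilinear_tmap) (simp add: tmap_def)

lemma tmap_id: "tmap (\<lambda>x. x) (\<lambda>y. y) t = t"
  by (induction t rule: tensor_induct)
    (simp_all add: tmap_tens clinear_id clinear_add[OF clinear_tmap])

lemma clinear_inv:
  assumes "clinear f" "bij f"
  shows "clinear (inv f)"
proof (rule clinearI)
  note surj = surj_f_inv_f[OF bij_is_surj[OF assms(2)]]
  show "inv f (x + y) = inv f x + inv f y" for x y
    by (rule inv_f_eq[OF bij_is_inj[OF assms(2)]]) (simp add: clinear_add[OF assms(1)] surj)
  show "inv f (c *\<^sub>C x) = c *\<^sub>C inv f x" for c x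
    by (rule inv_f_eq[OF bij_is_inj[OF assms(2)]]) (simp add: clinear_scaleC[OF assms(1)] surj)
qed

lemma alg_homD: "alg_hom f \<Longrightarrow> clinear f" "alg_hom f \<Longrightarrow> f 1 = 1"
  by (simp_all add: alg_hom_def)

section \<open>The coaction of the affine extension on V\<close>

context affine_extension
begin

text \<open>The retraction is \<open>\<epsilon> \<otimes> id\<close> on \<open>\<A> \<otimes> S(V)\<close>, transported by the isomorphism \<open>decomposition\<close>.\<close>

lemma inS_retraction: "\<exists>R. clinear R \<and> (\<forall>s. R (inS s) = s)"
proof -
  define f where "f = tsum (\<lambda>a s. inA a * inS s)"
  define e :: "('a, 's) tensor \<Rightarrow> 's" where "e = tsum (\<lambda>a s. counit a *\<^sub>C s)"
  have bil: "cbilinear (\<lambda>a s. inA a * inS s)"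
    by (rule cbilinear_compose[OF cbilinear_mult alg_homD(1)[OF inA_hom] alg_homD(1)[OF inS_hom]])
  have bil': "cbilinear (\<lambda>a (s :: 's). counit a *\<^sub>C s)"
    by (rule cbilinear_compose[OF cbilinear_scaleC(1) alg_homD(1)[OF counit_hom] clinear_id(2)])
  have "bij f" "clinear f" "clinear e"
    using decomposition by (simp_all add: f_def e_def clinear_tsum bil bil')
  moreover have "f (1 \<otimes> s) = inS s" for s
    by (simp add: f_def cbilinear_balanced[OF bil] alg_homD(2)[OF inA_hom])
  then have "inv f (inS s) = 1 \<otimes> s" for s
    using \<open>bij f\<close> by (metis bij_inv_eq_iff)
  moreover have "e (1 \<otimes> s) = s" for s
    by (simp add: e_def cbilinear_balanced[OF bil'] alg_homD(2)[OF counit_hom] scaleC_one)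
  ultimately show ?thesis
    by (intro exI[of _ "\<lambda>t. e (inv f t)"]) (simp add: clinear_compose clinear_inv)
qed

text \<open>The axiom \<open>coactE_eq\<close> determines \<open>coactE\<close> only after embedding
  the first leg by \<open>inS\<close>. Applying the retraction of \<open>inS\<close> to that leg
  undoes the embedding in the formula for the coproduct on V.\<close>

lemma coactE_inV: "coactE (inV \<theta>) = 1 \<otimes> inS (inV \<theta>) + tmap inV inA (coactV \<theta>)"
proof -
  note lin = alg_homD(1)[OF inA_hom] alg_homD(1)[OF inS_hom] inV_linear clinear_id
  obtain R where R: "clinear R" "\<And>s. R (inS s) = s"
    using inS_retraction by blast
  have "tmap R id (tmap inS id (coactE (inV \<theta>))) = coactE (inV \<theta>)"
    by (simp add: tmap_tmap lin R tmap_id)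
  moreover have "tmap R id (tmap inS id (coactE (inV \<theta>)))
      = tmap R id (1 \<otimes> inS (inV \<theta>) + tmap (\<lambda>\<theta>. inS (inV \<theta>)) inA (coactV \<theta>))"
    by (simp add: coactE_eq comultE_inV comp_def)
  \<comment> \<open>The unit in the first leg is written as \<open>inS 1\<close>, the form in which
    \<open>R\<close> is known to send it to the unit of S(V).\<close>
  moreover have "\<dots> = R (inS 1) \<otimes> inS (inV \<theta>) + tmap inV inA (coactV \<theta>)"
    by (simp add: clinear_add[OF clinear_tmap] tmap_tens tmap_tmap lin R clinear_compose
        alg_homD(2)[OF inS_hom])
  ultimately show ?thesis
    by (simp add: R)
qed

end

section \<open>The twisted product on horizontal forms of the affine bundle\<close>

context affine_bundle
begin

text \<open>The product is a nest of three \<open>tsum\<close>. Bilinearity is proved from the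
  innermost layer outwards, since each layer must be balanced before it can be evaluated on
  elementary tensors.\<close>

lemma cbilinear_hmult_inner: "cbilinear (\<lambda>\<phi>' c. ((\<psi> :: 'h) * \<phi>') \<otimes> (actS \<theta> c * \<eta>))"
  by (intro cbilinear_tmap clinear_compose[OF cbilinearD(2)[OF cbilinear_mult]]
      cbilinearD(1)[OF cbilinear_mult] cbilinearD(1)[OF actS_bilinear])

lemma cbilinear_hmult_right:
  "cbilinear (\<lambda>\<phi> \<eta>. tsum (\<lambda>\<phi>' c. (\<psi> * \<phi>') \<otimes> (actS \<theta> c * \<eta>)) (Fh \<phi>))"
  by (intro cbilinearI clinear_tsum_parameter
      clinear_compose[OF clinear_tsum[OF cbilinear_hmult_inner] Fh_linear]
      clinear_compose[OF cbilinearD(1)[OF cbilinear_tens]] cbilinearD(1)[OF cbilinear_mult])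

lemma cbilinear_hmult_left:
  "cbilinear (\<lambda>\<psi> \<theta>. tsum (\<lambda>\<phi> \<eta>. tsum (\<lambda>\<phi>' c. (\<psi> * \<phi>') \<otimes> (actS \<theta> c * \<eta>)) (Fh \<phi>)) w)"
  by (intro cbilinearI clinear_tsum_parameter clinear_compose[OF cbilinearD(1)[OF cbilinear_tens]]
      clinear_compose[OF cbilinearD(2)[OF cbilinear_tens]]
      clinear_compose[OF cbilinearD(2)[OF cbilinear_mult]]
      cbilinearD(2)[OF cbilinear_mult] cbilinearD(2)[OF actS_bilinear])

lemma cbilinear_hmult: "cbilinear (hmult Fh actS)"
  unfolding hmult_def
  by (intro cbilinearI clinear_tsum_parameter clinear_tsum cbilinear_hmult_left
      cbilinear_hmult_right)

text \<open>The algebra acts on the unit of S(V) through its counit, so the twist by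
  \<open>Fh\<close> collapses by the counit axiom, and a horizontal left factor multiplies the first
  leg only.\<close>

lemma hmult_horizontal: "hmult Fh actS (\<psi> \<otimes> 1) u = tmap ((*) \<psi>) id u"
proof (induction u rule: tensor_induct)
  case (tens \<phi> \<eta>)
  \<comment> \<open>This linearity gathers the sum over \<open>Fh \<phi>\<close> inside the first
    leg, where \<open>Fh_counit\<close> evaluates it.\<close>
  have lin: "clinear (\<lambda>x. (\<psi> * x) \<otimes> \<eta>)"
    by (rule clinear_compose[OF cbilinearD(2)[OF cbilinear_tens] cbilinearD(1)[OF cbilinear_mult]])
  have "hmult Fh actS (\<psi> \<otimes> 1) (\<phi> \<otimes> \<eta>)
      = tsum (\<lambda>\<phi>' c. (\<psi> * \<phi>') \<otimes> (actS 1 c * \<eta>)) (Fh \<phi>)"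
    unfolding hmult_def
    unfolding tsum_tens[OF cbilinear_balanced[OF cbilinear_hmult_left]]
    by (rule tsum_tens[OF cbilinear_balanced[OF cbilinear_hmult_right]])
  also have "\<dots> = tsum (\<lambda>\<phi>' c. (\<psi> * (counit c *\<^sub>C \<phi>')) \<otimes> \<eta>) (Fh \<phi>)"
    by (simp add: actS_one mult_scaleC_left mult_scaleC_right tens_scaleC_left tens_scaleC_right)
  also have "\<dots> = (\<psi> * \<phi>) \<otimes> \<eta>"
    using clinear_apply_tsum[OF lin, of "\<lambda>\<phi>' c. counit c *\<^sub>C \<phi>'" "Fh \<phi>"]
    by (simp add: Fh_counit)
  finally show ?case
    by (simp add: tmap_tens cbilinearD(1)[OF cbilinear_mult] clinear_id)
next
  case (add s t)
  then show ?case
    by (simp add: clinear_add[OF cbilinearD(1)[OF cbilinear_hmult]]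
        clinear_add[OF clinear_tmap] cbilinearD(1)[OF cbilinear_mult] clinear_id)
qed

lemma hmult_one_left: "hmult Fh actS (1 \<otimes> 1) u = u"
proof -
  have "(*) 1 = (\<lambda>x :: 'h. x)"
    by auto
  then show ?thesis
    by (simp only: hmult_horizontal id_def tmap_id)
qed

lemma hmult_horizontal_tens: "hmult Fh actS (\<psi> \<otimes> 1) (\<phi> \<otimes> \<eta>) = (\<psi> * \<phi>) \<otimes> \<eta>"
  by (simp add: hmult_horizontal tmap_tens cbilinearD(1)[OF cbilinear_mult] clinear_id)

text \<open>Horizontal left factors act on the first leg alone, so this is associativity of the
  original horizontal forms.\<close>

lemma hmult_horizontal_assoc:
  "hmult Fh actS (\<psi> \<otimes> 1) (hmult Fh actS (\<phi> \<otimes> 1) u) = hmult Fh actS ((\<psi> * \<phi>) \<otimes> 1) u"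
proof -
  have "(*) (\<psi> * \<phi>) = (\<lambda>x. \<psi> * (\<phi> * x))"
    by (auto simp: mult.assoc)
  then show ?thesis
    by (simp add: hmult_horizontal tmap_tmap cbilinearD(1)[OF cbilinear_mult] clinear_id id_def)
qed

text \<open>The retraction is \<open>id \<otimes> \<epsilon>\<close>.\<close>

lemma horizontal_retraction: "\<exists>E. clinear E \<and> (\<forall>\<phi>. E (\<phi> \<otimes> (1 :: 's)) = (\<phi> :: 'h))"
proof -
  \<comment> \<open>The counit of S(V) is obtained by restricting the counit of the affine extension
    along \<open>inS\<close>.\<close>
  define E :: "('h, 's) tensor \<Rightarrow> 'h" where "E = tsum (\<lambda>\<phi> s. counitE (inS s) *\<^sub>C \<phi>)"
  have bil: "cbilinear (\<lambda>(\<phi> :: 'h) s. counitE (inS s) *\<^sub>C \<phi>)"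
    by (rule cbilinear_compose[OF cbilinear_scaleC(2) clinear_id(2)
          clinear_compose[OF alg_homD(1)[OF ext.counit_hom] alg_homD(1)[OF inS_hom]]])
  show ?thesis
    by (rule exI[of _ E])
      (simp add: E_def clinear_tsum bil cbilinear_balanced[OF bil] alg_homD(2)[OF inS_hom]
        alg_homD(2)[OF ext.counit_hom] scaleC_one)
qed

lemma clinear_horizontal: "clinear (\<lambda>\<phi> :: 'h. \<phi> \<otimes> (1 :: 's))"
  by (rule cbilinearD(2)[OF cbilinear_tens])

section \<open>The curvature on the original quantum group and on V\<close>

lemma curvature_horizontal:
  assumes "is_curvature (hmult Fh actS) H D \<rho>"
  shows "D (D (\<phi> \<otimes> 1)) = - tsum (\<lambda>\<phi>' c. hmult Fh actS (\<phi>' \<otimes> 1) (\<rho> (inA c))) (Fh \<phi>)"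
proof -
  have "clinear \<rho>"
    using assms by (simp add: is_curvature_def)
  then have "tsum (\<lambda>x c. hmult Fh actS x (\<rho> c)) (tmap (\<lambda>\<psi>. \<psi> \<otimes> 1) inA (Fh \<phi>))
      = tsum (\<lambda>\<phi>' c. hmult Fh actS (\<phi>' \<otimes> 1) (\<rho> (inA c))) (Fh \<phi>)"
    by (intro tsum_tmap cbilinear_compose[OF cbilinear_hmult] clinear_id clinear_horizontal
        alg_homD(1)[OF inA_hom])
  then show ?thesis
    using assms by (simp add: is_curvature_def H_horizontal)
qed

lemma curvature_inA_horizontal:
  assumes curv: "is_curvature (hmult Fh actS) H D \<rho>"
    and D_hor: "\<And>\<phi>. D (\<phi> \<otimes> 1) = D_hor \<phi> \<otimes> 1"
  shows "\<exists>\<psi>. \<rho> (inA a) = \<psi> \<otimes> 1"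
proof -
  \<comment> \<open>\<open>L\<close> lives on the codomain of the canonical map and returns
    \<rho>(a) at 1 \<otimes> a, so the curvature can be computed from a preimage of 1 \<otimes>
    a.\<close>
  define L where "L = tsum (\<lambda>b a. hmult Fh actS (inB b \<otimes> 1) (\<rho> (inA a)))"
  have "clinear \<rho>"
    using curv by (simp add: is_curvature_def)
  then have bil': "cbilinear (\<lambda>\<phi> a. hmult Fh actS (\<phi> \<otimes> 1) (\<rho> (inA a)))"
    by (intro cbilinear_compose[OF cbilinear_hmult] clinear_horizontal
        clinear_compose[of \<rho> inA] alg_homD(1)[OF inA_hom])
  have bil: "cbilinear (\<lambda>b a. hmult Fh actS (inB b \<otimes> 1) (\<rho> (inA a)))"
    by (rule cbilinear_compose[OF bil' alg_homD(1)[OF inB_hom] clinear_id(2)])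
  have tmult_eq: "tmult (*) (*) (q \<otimes> 1) t = tmap ((*) q) id t" for q :: 'b and t :: "('b, 'a) tensor"
  proof -
    have "balanced (\<lambda>x y. tsum (\<lambda>x' y'. (x * x') \<otimes> (y * y')) t)"
      by (intro cbilinear_balanced cbilinearI clinear_tsum_parameter
          clinear_compose[OF cbilinearD(1)[OF cbilinear_tens]]
          clinear_compose[OF cbilinearD(2)[OF cbilinear_tens]] cbilinearD(2)[OF cbilinear_mult])
    then show ?thesis
      by (simp add: tmult_def tmap_def)
  qed
  \<comment> \<open>Since \<open>inB\<close> is multiplicative, q can be pulled out of the sum by
    \<open>hmult_horizontal_assoc\<close>. What remains is the curvature identity for the
    degree-zero form \<open>inB b\<close>, whose coaction is transported from \<open>F\<close> by
    \<open>Fh_inB\<close>.\<close>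
  have L_can: "L (tmult (*) (*) (q \<otimes> 1) (F b)) = (- (inB q * D_hor (D_hor (inB b)))) \<otimes> 1" for q b
  proof -
    have "L (tmult (*) (*) (q \<otimes> 1) (F b))
        = tsum (\<lambda>b a. hmult Fh actS (inB (q * b) \<otimes> 1) (\<rho> (inA a))) (F b)"
      unfolding tmult_eq L_def
      by (simp add: tsum_tmap[OF bil] cbilinearD(1)[OF cbilinear_mult] clinear_id)
    also have "\<dots> = tsum (\<lambda>b a. hmult Fh actS (inB q \<otimes> 1)
        (hmult Fh actS (inB b \<otimes> 1) (\<rho> (inA a)))) (F b)"
      using inB_hom by (simp add: hmult_horizontal_assoc alg_hom_def)
    also have "\<dots> = hmult Fh actS (inB q \<otimes> 1)
        (tsum (\<lambda>b a. hmult Fh actS (inB b \<otimes> 1) (\<rho> (inA a))) (F b))"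
      by (simp add: clinear_apply_tsum[OF cbilinearD(1)[OF cbilinear_hmult]])
    also have "tsum (\<lambda>b a. hmult Fh actS (inB b \<otimes> 1) (\<rho> (inA a))) (F b)
        = tsum (\<lambda>\<phi> a. hmult Fh actS (\<phi> \<otimes> 1) (\<rho> (inA a))) (Fh (inB b))"
      unfolding Fh_inB by (simp add: tsum_tmap[OF bil'] alg_homD(1)[OF inB_hom] clinear_id)
    also have "\<dots> = (- D_hor (D_hor (inB b))) \<otimes> 1"
      using curvature_horizontal[OF curv, of "inB b"] clinear_minus[OF clinear_horizontal]
      by (simp add: D_hor)
    finally show ?thesis
      by (simp add: hmult_horizontal_tens)
  qed
  have L_linear: "clinear L"
    by (simp add: L_def clinear_tsum bil)
  \<comment> \<open>\<open>T\<close> is a preimage of 1 \<otimes> a under the canonical map, taken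
    in the full tensor square of the bundle algebra rather than the one balanced over the
    base.\<close>
  obtain T where T: "1 \<otimes> a = tsum (\<lambda>q b. tmult (*) (*) (q \<otimes> 1) (F b)) T"
    using surjD[OF canonical_map_surj] by blast
  have "\<rho> (inA a) = L (1 \<otimes> a)"
    unfolding L_def tsum_tens[OF cbilinear_balanced[OF bil]]
    by (simp only: alg_homD(2)[OF inB_hom] hmult_one_left)
  also have "\<dots> = tsum (\<lambda>q b. (- (inB q * D_hor (D_hor (inB b)))) \<otimes> 1) T"
    by (simp add: T clinear_apply_tsum[OF L_linear] L_can)
  \<comment> \<open>The elements \<phi> \<otimes> 1 form the range of a linear map, so the whole sum
    again has this form.\<close>
  also have "\<dots> = tsum (\<lambda>q b. - (inB q * D_hor (D_hor (inB b)))) T \<otimes> 1"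
    by (rule clinear_apply_tsum[OF clinear_horizontal, symmetric])
  finally show ?thesis
    by blast
qed

lemma curvature_restricts:
  assumes curv: "is_curvature (hmult Fh actS) H D \<rho>"
    and D_hor: "\<And>\<phi>. D (\<phi> \<otimes> 1) = D_hor \<phi> \<otimes> 1"
  shows "\<exists>\<rho>_hor. is_curvature (*) Fh D_hor \<rho>_hor \<and> (\<forall>a. \<rho> (inA a) = \<rho>_hor a \<otimes> 1)"
proof -
  obtain E :: "('h, 's) tensor \<Rightarrow> 'h" where E: "clinear E" "\<And>\<phi>. E (\<phi> \<otimes> 1) = \<phi>"
    using horizontal_retraction by blast
  \<comment> \<open>Choosing a horizontal \<open>\<psi>\<close> separately for each a would not give
    a linear map. The retraction \<open>E\<close> recovers that \<open>\<psi>\<close>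
    linearly.\<close>
  define \<rho>_hor where "\<rho>_hor = (\<lambda>a. E (\<rho> (inA a)))"
  have \<rho>: "\<rho> (inA a) = \<rho>_hor a \<otimes> 1" for a
    using curvature_inA_horizontal[OF curv D_hor, of a] by (auto simp: \<rho>_hor_def E)
  have "clinear \<rho>_hor"
    unfolding \<rho>_hor_def using curv
    by (intro clinear_compose[OF E(1)] clinear_compose[of \<rho> inA] alg_homD(1)[OF inA_hom])
      (simp add: is_curvature_def)
  moreover have "D_hor (D_hor \<phi>) = - tsum (\<lambda>\<phi>' c. \<phi>' * \<rho>_hor c) (Fh \<phi>)" for \<phi>
  proof -
    have "D_hor (D_hor \<phi>) = E (D (D (\<phi> \<otimes> 1)))"
      by (simp add: D_hor E)
    also have "\<dots> = - tsum (\<lambda>\<phi>' c. E (hmult Fh actS (\<phi>' \<otimes> 1) (\<rho> (inA c)))) (Fh \<phi>)"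
      by (simp only: curvature_horizontal[OF curv] clinear_minus[OF E(1)] clinear_apply_tsum[OF E(1)])
    finally show ?thesis
      by (simp add: \<rho> hmult_horizontal_tens E)
  qed
  ultimately show ?thesis
    using \<rho> by (auto simp: is_curvature_def)
qed

lemma curvature_inV:
  assumes curv: "is_curvature (hmult Fh actS) H D \<rho>"
  shows "\<rho> (inS (inV \<theta>))
    = - tsum (\<lambda>\<theta>' c. hmult Fh actS (1 \<otimes> inV \<theta>') (\<rho> (inA c))) (coactV \<theta>) - D (D (1 \<otimes> inV \<theta>))"
proof -
  have "clinear \<rho>"
    using curv by (simp add: is_curvature_def)
  then have bil: "cbilinear (\<lambda>x c. hmult Fh actS x (\<rho> c))"
    by (intro cbilinear_compose[OF cbilinear_hmult] clinear_id)
  note lin = cbilinearD(1)[OF cbilinear_tens] clinear_id inV_linear alg_homD(1)[OF inA_hom]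
  \<comment> \<open>The term with first leg 1 \<otimes> 1, a left unit for the product, isolates
    \<rho>(\<theta>) in the curvature identity, which can then be solved for it.\<close>
  have "H (1 \<otimes> inV \<theta>) = (1 \<otimes> 1) \<otimes> inS (inV \<theta>) + tmap (\<lambda>\<theta>'. 1 \<otimes> inV \<theta>') inA (coactV \<theta>)"
    by (simp add: H_symmetric coactE_inV clinear_add[OF clinear_tmap] tmap_tens tmap_tmap lin)
  then have "D (D (1 \<otimes> inV \<theta>)) = - (\<rho> (inS (inV \<theta>))
      + tsum (\<lambda>\<theta>' c. hmult Fh actS (1 \<otimes> inV \<theta>') (\<rho> (inA c))) (coactV \<theta>))"
    using curv
    by (simp add: is_curvature_def clinear_add[OF clinear_tsum[OF bil]] cbilinear_balanced[OF bil]
        hmult_one_left tsum_tmap[OF bil] clinear_compose lin)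
  then show ?thesis
    by simp
qed

end

theorem proposition3p3:
  fixes comult :: "'a::complex_star_algebra \<Rightarrow> ('a, 'a) tensor"
    and F :: "'b::complex_star_algebra \<Rightarrow> ('b, 'a) tensor"
    and deg :: "nat \<Rightarrow> 'h::{complex_algebra_1, complex_star_vector} set"
    and lact :: "'a \<Rightarrow> 'p::complex_star_vector \<Rightarrow> 'p"
    and incl :: "'v::complex_star_vector \<Rightarrow> 'p"
    and inV :: "'v \<Rightarrow> 's::complex_star_algebra"
    and comultE :: "'t::complex_star_algebra \<Rightarrow> ('t, 't) tensor"
    and H :: "('h, 's) tensor \<Rightarrow> (('h, 's) tensor, 't) tensor"
    and D :: "('h, 's) tensor \<Rightarrow> ('h, 's) tensor"
    and D_hor :: "'h \<Rightarrow> 'h"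
    and lam :: "'v \<Rightarrow> 'h"
    and \<rho> :: "'t \<Rightarrow> ('h, 's) tensor"
  assumes "affine_bundle comult counit antipode F deg inB Fh dM lact ract lcoact rcoact
             incl coactV actV inV coactS actS comultE counitE antipodeE inA inS coactE H"
    and "affine_bundle_derivative deg Fh dM actS H D"
    and D_hor: "\<And>\<phi>. D (\<phi> \<otimes> 1) = D_hor \<phi> \<otimes> 1"
    and lam: "\<And>\<theta>. D (1 \<otimes> inV \<theta>) = lam \<theta> \<otimes> 1"
    and "is_curvature (hmult Fh actS) H D \<rho>"
  shows "(\<exists>\<rho>_hor. is_curvature (*) Fh D_hor \<rho>_hor \<and> (\<forall>a. \<rho> (inA a) = \<rho>_hor a \<otimes> 1)) \<and>
    (\<forall>\<theta>. \<rho> (inS (inV \<theta>)) =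
       - tsum (\<lambda>\<theta>' c. hmult Fh actS (1 \<otimes> inV \<theta>') (\<rho> (inA c))) (coactV \<theta>) - D (lam \<theta> \<otimes> 1))"
proof -
  interpret affine_bundle comult counit antipode F deg inB Fh dM lact ract lcoact rcoact
    incl coactV actV inV coactS actS comultE counitE antipodeE inA inS coactE H
    by (rule assms(1))
  \<comment> \<open>In \<open>curvature_inV\<close> the map \<open>D\<close> is applied twice to 1
    \<otimes> \<theta>. Rewriting by \<open>lam\<close> replaces the inner value by the horizontal
    form \<lambda>(\<theta>).\<close>
  show ?thesis
    using curvature_restricts[OF assms(5) D_hor] curvature_inV[OF assms(5)] by (simp add: lam)
qed

end
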